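(* Let $T$ be a rooted homogeneous tree of order $\gamma$ and let $B$ be the backward shift on $\mathcal{L}_0$. Then, for every $n\in\mathbb{N}$, $\|B^n\|=n+1$ if $\gamma=1$, and $\|B^n\|=(2n+1)\gamma^n-2n\gamma^{n-1}$ if $\gamma\ge 2$.
   Context: $\mathbb{N}=\{1,2,\dots\}$. A tree is an undirected graph (no loops or multiple edges) in which any two vertices are joined by exactly one path; $T$ also denotes its vertex set, which is assumed countably infinite, and every vertex has finite degree. $T$ has a distinguished vertex $o$, the root; $|v|$ is the length (number of edges) of the path from $o$ to $v$. For $v\neq o$, the parent $\mathrm{par}(v)$ is the vertex preceding $v$ on the unique path from $o$ to $v$; $\mathrm{Chi}(v)$ is the set of children of $v$ (vertices with parent $v$), and $\gamma(v)$ is its cardinality. $T$ is homogeneous of order $\gamma$ if $\gamma(v)=\gamma$ for all $v\in T$ (so $\gamma\geq 1$). For $f:T\to\mathbb{C}$ define $f'(o)=f(o)$ and $f'(v)=f(v)-f(\mathrm{par}(v))$ for $v\neq o$. The little Lipschitz space $\mathcal{L}_0$ is the Banach space of all $f:T\to\mathbb{C}$ with $\lim_{|v|\to\infty}f'(v)=0$, with norm $\|f\|=\sup_{v\in T}|f'(v)|$. The backward shift is $(Bf)(v)=\sum_{w\in\mathrm{Chi}(v)}f(w)$. *)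

theory Defs
  imports "HOL-Analysis.Analysis" "Graph_Theory.Graph_Theory"
begin

text \<open>
  An undirected simple graph is a symmetric, loop-free set of arcs (a locale without finiteness
  assumption). The predicate \<open>tree\<close> of the graph library is not used: it is meant for
  digraphs, and a symmetric digraph with at least one edge never satisfies it, since traversing an
  edge back and forth counts as a cycle there.
\<close>

locale rooted_tree = pair_bidirected_digraph T
  for T :: "'a pair_pre_digraph" +
  fixes root :: 'a
  assumes root_in_verts: "root \<in> pverts T"
    and unique_path: "\<And>u v. u \<in> pverts T \<Longrightarrow> v \<in> pverts T \<Longrightarrow> \<exists>!p. apath u p v"
    and infinite_verts: "infinite (pverts T)"
    and countable_verts: "countable (pverts T)"
    and finite_degree: "\<And>v. v \<in> pverts T \<Longrightarrow> finite (out_arcs T v)"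
begin

definition path_to :: "'a \<Rightarrow> ('a \<times> 'a) awalk" where
  "path_to v = (THE p. apath root p v)"

definition level :: "'a \<Rightarrow> nat" where
  "level v = length (path_to v)"

text \<open>The last arc of the path from the root to \<open>v\<close> is the arc from the parent of \<open>v\<close> to \<open>v\<close>.\<close>

definition par :: "'a \<Rightarrow> 'a" where
  "par v = fst (last (path_to v))"

definition Chi :: "'a \<Rightarrow> 'a set" where
  "Chi v = {w \<in> pverts T. w \<noteq> root \<and> par w = v}"

definition homogeneous :: "nat \<Rightarrow> bool" where
  "homogeneous \<gamma> \<longleftrightarrow> (\<forall>v\<in>pverts T. card (Chi v) = \<gamma>)"

definition tderiv :: "('a \<Rightarrow> complex) \<Rightarrow> 'a \<Rightarrow> complex" where
  "tderiv f v = (if v = root then f root else f v - f (par v))"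

text \<open>
  A complex function on the vertex set is represented by a function on the whole type that
  vanishes off the vertex set.
\<close>

definition L0 :: "('a \<Rightarrow> complex) set" where
  "L0 = {f. (\<forall>v. v \<notin> pverts T \<longrightarrow> f v = 0) \<and>
            (tderiv f \<longlongrightarrow> 0) (inf (filtercomap level at_top) (principal (pverts T)))}"

definition L_norm :: "('a \<Rightarrow> complex) \<Rightarrow> real" where
  "L_norm f = (SUP v\<in>pverts T. cmod (tderiv f v))"

definition bounded_linear_L0 :: "(('a \<Rightarrow> complex) \<Rightarrow> 'a \<Rightarrow> complex) \<Rightarrow> bool" where
  "bounded_linear_L0 A \<longleftrightarrow>
     (\<forall>f\<in>L0. A f \<in> L0) \<and>
     (\<forall>f\<in>L0. \<forall>g\<in>L0. A (\<lambda>v. f v + g v) = (\<lambda>v. A f v + A g v)) \<and>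
     (\<forall>c. \<forall>f\<in>L0. A (\<lambda>v. c * f v) = (\<lambda>v. c * A f v)) \<and>
     (\<exists>K. \<forall>f\<in>L0. L_norm (A f) \<le> K * L_norm f)"

text \<open>Only meaningful if \<open>A\<close> satisfies the preceding predicate, as the supremum is a real one.\<close>

definition op_norm_L0 :: "(('a \<Rightarrow> complex) \<Rightarrow> 'a \<Rightarrow> complex) \<Rightarrow> real" where
  "op_norm_L0 A = (SUP f\<in>{f \<in> L0. L_norm f \<le> 1}. L_norm (A f))"

definition backward_shift :: "('a \<Rightarrow> complex) \<Rightarrow> 'a \<Rightarrow> complex" where
  "backward_shift f v = (\<Sum>w\<in>Chi v. f w)"

end

end

theory Submission
  imports Defs
begin

text \<open>
  Write \<open>S\<^sub>n = B\<^sup>n f\<close>; its value at \<open>v\<close> is the sum of \<open>f\<close> over the \<open>\<gamma>\<^sup>n\<close> descendants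
  of \<open>v\<close> that lie \<open>n\<close> generations below it. The derivative of \<open>S\<^sub>n\<close> at \<open>v \<noteq> root\<close> compares
  the descendants of \<open>v\<close> with those of its parent \<open>p\<close>. A part of the latter also lies in the
  subtree of \<open>v\<close>, one level higher, so the paths to the two families share edges there. Expanding every value of \<open>f\<close> into increments
  along edges below \<open>p\<close> gives \<open>f(p)\<close> the total coefficient zero, and the absolute values of the
  coefficients of the increments add up as follows:

    \<^item> \<open>(\<gamma> - 1) \<gamma>\<^sup>n\<^sup>-\<^sup>1\<close> for each of the \<open>n\<close> generations from \<open>v\<close> down to \<open>n - 1\<close> levels below it,
      where an increment occurs in both sums, and \<open>\<gamma>\<^sup>n\<close> for the generation \<open>n\<close> levels below \<open>v\<close>;
    \<^item> \<open>(\<gamma> - 1) \<gamma>\<^sup>n\<^sup>-\<^sup>1\<close> for each of \<open>n\<close> generations of the subtrees of the siblings of \<open>v\<close>.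

  The total is \<open>\<gamma>\<^sup>n + 2n (\<gamma> - 1) \<gamma>\<^sup>n\<^sup>-\<^sup>1 = (2n + 1) \<gamma>\<^sup>n - 2n \<gamma>\<^sup>n\<^sup>-\<^sup>1\<close>. At the root there is
  nothing to subtract and the total is \<open>(n + 1) \<gamma>\<^sup>n\<close>, which is the larger of the two for \<open>\<gamma> = 1\<close>
  and at most the first one for \<open>\<gamma> \<ge> 2\<close>. The estimates are obtained without naming the sets of
  descendants: \<open>norm_funpow_shift_minus\<close> and \<open>norm_shift_increment_minus\<close> are inductions on
  \<open>n\<close> whose step is \<open>norm_sum_minus_le\<close>, and \<open>tderiv_shift_nonroot_le\<close> assembles them.
  They only involve increments at levels from that of \<open>v\<close> on, so the same estimates show
  that \<open>B\<^sup>n f\<close> stays in the space.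

  The bounds are attained by functions of the form \<open>s(w) \<phi>(|w|)\<close> with a sign \<open>s\<close>: for \<open>\<gamma> = 1\<close> all
  increments up to level \<open>n\<close> are \<open>1\<close>, and for \<open>\<gamma> \<ge> 2\<close> the increments are \<open>1\<close> in the subtree below
  one child of the root and \<open>-1\<close> in the subtrees of its siblings, up to level \<open>n + 1\<close>.
\<close>

section \<open>Parents, children and levels\<close>

context rooted_tree
begin

lemma path_to_unique:
  assumes "apath root p v"
  shows "path_to v = p"
proof -
  have "v \<in> pverts T"
    using assms by (auto simp: apath_def dest: awalk_last_in_verts)
  then show ?thesis
    unfolding path_to_def using assms unique_path[OF root_in_verts] by blast
qed

lemma apath_path_to:
  assumes "v \<in> pverts T"
  shows "apath root (path_to v) v"
  using unique_path[OF root_in_verts assms] path_to_unique by blast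

text \<open>A simple path that ends at \<open>v\<close> is, without its last arc, a simple path to the tail of that arc;
  by uniqueness it is the path that defines the level of this tail.\<close>

lemma path_to_snoc:
  assumes "v \<in> pverts T" "v \<noteq> root"
  obtains u where "(u, v) \<in> parcs T" "path_to v = path_to u @ [(u, v)]"
proof -
  have p: "apath root (path_to v) v"
    using assms by (simp add: apath_path_to)
  have "path_to v \<noteq> []"
    using p assms by (auto simp: apath_Nil_iff)
  then obtain q a b where q: "path_to v = q @ [(a, b)]"
    by (metis rev_exhaust surj_pair)
  have "apath root q (awlast root q)" "apath (awlast root q) [(a, b)] v"
    using p unfolding q apath_append_iff by auto
  then have "apath root q a" "(a, v) \<in> parcs T" "b = v"
    by (auto simp: apath_Cons_iff apath_Nil_iff)
  then show thesis
    using that[of a] q path_to_unique by auto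
qed

lemma par_arc:
  assumes "v \<in> pverts T" "v \<noteq> root"
  shows "(par v, v) \<in> parcs T"
  by (rule path_to_snoc[OF assms]) (simp add: par_def)

lemma par_in_verts:
  assumes "v \<in> pverts T" "v \<noteq> root"
  shows "par v \<in> pverts T"
  using par_arc[OF assms] by (auto dest: in_arcsD1)

lemma level_eq_Suc:
  assumes "v \<in> pverts T" "v \<noteq> root"
  shows "level v = Suc (level (par v))"
  by (rule path_to_snoc[OF assms]) (simp add: par_def level_def)

lemma level_root: "level root = 0"
  using path_to_unique[of "[]" root] root_in_verts by (simp add: level_def apath_Nil_iff)

lemma level_eq_0_iff: "v \<in> pverts T \<Longrightarrow> level v = 0 \<longleftrightarrow> v = root"
  using level_eq_Suc level_root by fastforce

lemma ChiD:
  assumes "c \<in> Chi v"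
  shows "c \<in> pverts T" "c \<noteq> root" "par c = v" "v \<in> pverts T" "level c = Suc (level v)"
  using assms par_in_verts level_eq_Suc by (auto simp: Chi_def)

lemma Chi_eq_empty: "v \<notin> pverts T \<Longrightarrow> Chi v = {}"
  using ChiD(4) by blast

lemma in_Chi_par: "v \<in> pverts T \<Longrightarrow> v \<noteq> root \<Longrightarrow> v \<in> Chi (par v)"
  by (simp add: Chi_def)

lemma finite_Chi: "finite (Chi v)"
proof (cases "v \<in> pverts T")
  case True
  have "Chi v \<subseteq> snd ` out_arcs T v"
    using par_arc by (force simp: Chi_def out_arcs_def)
  then show ?thesis
    using finite_degree[OF True] by (meson finite_surj)
qed (simp add: Chi_eq_empty)

lemma finite_level_le: "finite {v \<in> pverts T. level v \<le> m}"
proof (induction m)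
  case 0
  have "{v \<in> pverts T. level v \<le> 0} \<subseteq> {root}"
    using level_eq_0_iff by auto
  then show ?case
    by (rule finite_subset) simp
next
  case (Suc m)
  have "{v \<in> pverts T. level v \<le> Suc m} \<subseteq> insert root (\<Union> (Chi ` {v \<in> pverts T. level v \<le> m}))"
    using in_Chi_par par_in_verts level_eq_Suc by fastforce
  then show ?case
    using Suc finite_Chi by (auto intro: finite_subset)
qed

lemma card_Chi: "homogeneous \<gamma> \<Longrightarrow> v \<in> pverts T \<Longrightarrow> card (Chi v) = \<gamma>"
  by (simp add: homogeneous_def)

lemma order_ge_1:
  assumes "homogeneous \<gamma>"
  shows "\<gamma> \<ge> 1"
proof -
  obtain v where v: "v \<in> pverts T" "v \<noteq> root"
    using infinite_verts by (metis finite.emptyI finite.insertI finite_subset insertI1 subsetI)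
  then have "card (Chi (par v)) > 0"
    using in_Chi_par finite_Chi by (auto simp: card_gt_0_iff)
  then show ?thesis
    using card_Chi[OF assms par_in_verts[OF v]] by simp
qed

section \<open>The norm of the little Lipschitz space\<close>

lemma tderiv_child: "c \<in> Chi v \<Longrightarrow> tderiv f c = f c - f v"
  using ChiD by (simp add: tderiv_def)

lemma tendsto_level_iff:
  "(g \<longlongrightarrow> (0::complex)) (inf (filtercomap level at_top) (principal (pverts T))) \<longleftrightarrow>
    (\<forall>e>0. \<exists>m. \<forall>v\<in>pverts T. m \<le> level v \<longrightarrow> cmod (g v) < e)"
  unfolding tendsto_iff eventually_inf_principal eventually_filtercomap_at_top_linorder
  by (auto simp: Ball_def; meson)

lemma L0_iff:
  "f \<in> L0 \<longleftrightarrow> (\<forall>v. v \<notin> pverts T \<longrightarrow> f v = 0) \<and>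
    (\<forall>e>0. \<exists>m. \<forall>v\<in>pverts T. m \<le> level v \<longrightarrow> cmod (tderiv f v) < e)"
  by (simp add: L0_def tendsto_level_iff)

text \<open>A real supremum is informative only for bounded sets. Here the derivative is small from some
  level on, and only finitely many vertices lie below that level.\<close>

lemma norm_tderiv_le_L_norm:
  assumes "f \<in> L0" "v \<in> pverts T"
  shows "cmod (tderiv f v) \<le> L_norm f"
proof -
  obtain m where m: "\<And>v. v \<in> pverts T \<Longrightarrow> m \<le> level v \<Longrightarrow> cmod (tderiv f v) < 1"
    using assms(1) unfolding L0_iff by (meson zero_less_one)
  let ?F = "(\<lambda>v. cmod (tderiv f v)) ` {v \<in> pverts T. level v \<le> m}"
  have "(\<lambda>v. cmod (tderiv f v)) ` pverts T \<subseteq> ?F \<union> {..1}"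
    using m by (force simp: not_le intro: less_imp_le)
  moreover have "bdd_above (?F \<union> {..1})"
    using finite_level_le by (simp add: bdd_above_finite)
  ultimately have "bdd_above ((\<lambda>v. cmod (tderiv f v)) ` pverts T)"
    by (meson bdd_above_mono)
  then show ?thesis
    unfolding L_norm_def using assms(2) by (rule cSUP_upper2) simp
qed

lemma L_norm_leI: "(\<And>v. v \<in> pverts T \<Longrightarrow> cmod (tderiv f v) \<le> K) \<Longrightarrow> L_norm f \<le> K"
  unfolding L_norm_def using root_in_verts by (auto intro: cSUP_least)

lemma op_norm_L0_eqI:
  assumes bound: "\<And>f. f \<in> L0 \<Longrightarrow> L_norm (A f) \<le> K * L_norm f" and "K \<ge> 0"
    and attained: "f \<in> L0" "L_norm f \<le> 1" "L_norm (A f) \<ge> K"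
  shows "op_norm_L0 A = K"
proof -
  have le: "L_norm (A g) \<le> K" if "g \<in> L0" "L_norm g \<le> 1" for g
    using bound[OF that(1)] mult_left_mono[OF that(2) \<open>K \<ge> 0\<close>] by simp
  then have "L_norm (A f) = K"
    using attained by (simp add: antisym)
  then show ?thesis
    unfolding op_norm_L0_def using le attained
    by (intro cSup_eq_maximum) (auto simp: image_iff)
qed

section \<open>Upper bounds for the derivative of an iterated shift\<close>

lemma funpow_shift_Suc:
  "(backward_shift ^^ Suc n) f v = (\<Sum>c\<in>Chi v. (backward_shift ^^ n) f c)"
  by (simp add: backward_shift_def)

end

text \<open>The common induction step of the two estimates below, with \<open>C\<close> the children of a vertex at which
  \<open>f\<close> has the value \<open>x\<close>, and \<open>A\<close> the iterated shift, or a difference of two iterated shifts, that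
  occurs in the induction hypothesis. The siblings of a vertex are a further instance of \<open>C\<close>.\<close>

lemma norm_sum_minus_le:
  fixes A f :: "'b \<Rightarrow> complex"
  assumes "\<And>c. c \<in> C \<Longrightarrow> cmod (A c - a * f c) \<le> K" "\<And>c. c \<in> C \<Longrightarrow> cmod (f c - x) \<le> M"
  shows "cmod ((\<Sum>c\<in>C. A c) - of_nat (card C) * a * x) \<le> real (card C) * (K + cmod a * M)"
proof -
  have "(\<Sum>c\<in>C. A c) - of_nat (card C) * a * x = (\<Sum>c\<in>C. (A c - a * f c) + a * (f c - x))"
    by (simp add: sum_subtractf algebra_simps)
  moreover have "cmod ((A c - a * f c) + a * (f c - x)) \<le> K + cmod a * M" if "c \<in> C" for c
    using assms[OF that]
    by (intro norm_triangle_le add_mono) (auto simp: norm_mult mult_left_mono)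
  ultimately show ?thesis
    by (simp only:) (rule sum_norm_bound)
qed

context rooted_tree
begin

context
  fixes \<gamma> m :: nat and f :: "'a \<Rightarrow> complex" and M :: real
  assumes hom: "homogeneous \<gamma>"
    and increment_le: "\<And>v. v \<in> pverts T \<Longrightarrow> m < level v \<Longrightarrow> cmod (tderiv f v) \<le> M"
begin

lemma child_increment_le: "c \<in> Chi v \<Longrightarrow> m \<le> level v \<Longrightarrow> cmod (f c - f v) \<le> M"
  using increment_le[of c] ChiD[of c v] tderiv_child[of c v f] by auto

lemma norm_funpow_shift_minus:
  assumes "v \<in> pverts T" "m \<le> level v"
  shows "cmod ((backward_shift ^^ n) f v - of_nat \<gamma> ^ n * f v) \<le> real n * real \<gamma> ^ n * M"
  using assms
proof (induction n arbitrary: v)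
  case 0
  then show ?case by simp
next
  case (Suc n)
  have "cmod ((backward_shift ^^ n) f c - of_nat \<gamma> ^ n * f c) \<le> real n * real \<gamma> ^ n * M"
    if "c \<in> Chi v" for c
    using that Suc ChiD[OF that] by simp
  from norm_sum_minus_le[of "Chi v", OF this child_increment_le]
  show ?case
    using Suc.prems card_Chi[OF hom]
    by (simp only: funpow_shift_Suc) (simp add: norm_power algebra_simps)
qed

text \<open>The increments below \<open>v\<close> that occur in both sums have to be estimated together: in each of the
  first \<open>n\<close> generations the coefficients of the difference add up to \<open>\<gamma>\<^sup>n\<^sup>+\<^sup>1 - \<gamma>\<^sup>n\<close>, whereas separate
  estimates of the two sums would give \<open>\<gamma>\<^sup>n\<^sup>+\<^sup>1 + \<gamma>\<^sup>n\<close>.\<close>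

lemma norm_shift_increment_minus:
  assumes "v \<in> pverts T" "m \<le> level v"
  shows "cmod ((backward_shift ^^ Suc n) f v - (backward_shift ^^ n) f v
             - of_nat (\<gamma> - 1) * of_nat \<gamma> ^ n * f v)
         \<le> (real \<gamma> ^ Suc n + real n * real (\<gamma> - 1) * real \<gamma> ^ n) * M"
  using assms
proof (induction n arbitrary: v)
  case 0
  have "of_nat \<gamma> = (1::complex) + of_nat (\<gamma> - 1)"
    using order_ge_1[OF hom] by (simp add: of_nat_diff)
  then show ?case
    using norm_funpow_shift_minus[OF 0, of 1] by (simp add: algebra_simps)
next
  case (Suc n)
  let ?A = "\<lambda>c. (backward_shift ^^ Suc n) f c - (backward_shift ^^ n) f c"
  have "cmod (?A c - of_nat (\<gamma> - 1) * of_nat \<gamma> ^ n * f c)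
      \<le> (real \<gamma> ^ Suc n + real n * real (\<gamma> - 1) * real \<gamma> ^ n) * M" if "c \<in> Chi v" for c
    using that Suc ChiD[OF that] by simp
  from norm_sum_minus_le[of "Chi v", OF this child_increment_le]
  have "cmod ((\<Sum>c\<in>Chi v. ?A c) - of_nat \<gamma> * (of_nat (\<gamma> - 1) * of_nat \<gamma> ^ n) * f v)
      \<le> real \<gamma> * ((real \<gamma> ^ Suc n + real n * real (\<gamma> - 1) * real \<gamma> ^ n) * M
          + cmod (of_nat (\<gamma> - 1) * of_nat \<gamma> ^ n) * M)"
    using Suc.prems card_Chi[OF hom] by simp
  moreover have "(\<Sum>c\<in>Chi v. ?A c)
      = (backward_shift ^^ Suc (Suc n)) f v - (backward_shift ^^ Suc n) f v"
    by (simp only: sum_subtractf flip: funpow_shift_Suc)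
  ultimately show ?case
    by (simp add: norm_mult norm_power algebra_simps del: funpow.simps)
qed

text \<open>With \<open>D = (\<gamma> - 1) \<gamma>\<^sup>n\<close>, the term \<open>D f(v)\<close> that the preceding estimate leaves over and the
  term \<open>D f(p)\<close> left over by the \<open>\<gamma> - 1\<close> siblings of \<open>v\<close> have the same coefficient, so
  together they cost a single increment, along the edge from \<open>p\<close> to \<open>v\<close>.\<close>

lemma tderiv_shift_nonroot_le:
  assumes "v \<in> pverts T" "v \<noteq> root" "m < level v"
  shows "cmod (tderiv ((backward_shift ^^ Suc n) f) v)
         \<le> (real \<gamma> ^ Suc n + 2 * real (Suc n) * real (\<gamma> - 1) * real \<gamma> ^ n) * M"
proof -
  define p where "p = par v"
  define D where "D = (of_nat (\<gamma> - 1) * of_nat \<gamma> ^ n :: complex)"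
  have p: "v \<in> Chi p" "p \<in> pverts T" "m \<le> level p"
    using assms in_Chi_par par_in_verts level_eq_Suc[of v] by (auto simp: p_def)
  let ?S = "\<lambda>n. (backward_shift ^^ n) f"
  have norm_D: "cmod D = real (\<gamma> - 1) * real \<gamma> ^ n"
    by (simp add: D_def norm_mult norm_power)
  have below: "cmod (?S (Suc n) v - ?S n v - D * f v)
      \<le> (real \<gamma> ^ Suc n + real n * cmod D) * M"
    using norm_shift_increment_minus[of v n] assms by (simp add: D_def norm_mult norm_power mult_ac)
  have edge: "cmod (D * (f v - f p)) \<le> cmod D * M"
    using child_increment_le[OF p(1,3)] by (simp add: norm_mult mult_left_mono)
  have card: "card (Chi p - {v}) = \<gamma> - 1"
    using p card_Chi[OF hom] finite_Chi by simp
  have "cmod ((\<Sum>c\<in>Chi p - {v}. ?S n c) - of_nat (card (Chi p - {v})) * of_nat \<gamma> ^ n * f p)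
      \<le> real (card (Chi p - {v})) * (real n * real \<gamma> ^ n * M + cmod (of_nat \<gamma> ^ n) * M)"
    using p ChiD[of _ p] norm_funpow_shift_minus child_increment_le
    by (intro norm_sum_minus_le[where f = f]) auto
  then have siblings: "cmod ((\<Sum>c\<in>Chi p - {v}. ?S n c) - D * f p) \<le> (real n + 1) * cmod D * M"
    by (simp add: card D_def norm_mult norm_power algebra_simps)
  have triangle: "cmod (a + b - c) \<le> A + B + C"
    if "cmod a \<le> A" "cmod b \<le> B" "cmod c \<le> C" for a b c A B C
    using norm_triangle_ineq4[of "a + b" c] norm_triangle_ineq[of a b] that by linarith
  have "?S (Suc n) p = ?S n v + (\<Sum>c\<in>Chi p - {v}. ?S n c)"
    unfolding funpow_shift_Suc using p finite_Chi by (simp add: sum.remove)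
  then have "tderiv (?S (Suc n)) v = (?S (Suc n) v - ?S n v - D * f v) + D * (f v - f p)
      - ((\<Sum>c\<in>Chi p - {v}. ?S n c) - D * f p)"
    by (simp add: tderiv_child[OF p(1)] algebra_simps del: funpow.simps)
  also have "cmod \<dots> \<le> (real \<gamma> ^ Suc n + real n * cmod D) * M + cmod D * M + (real n + 1) * cmod D * M"
    using below edge siblings by (rule triangle)
  also have "\<dots> = (real \<gamma> ^ Suc n + 2 * real (Suc n) * real (\<gamma> - 1) * real \<gamma> ^ n) * M"
    by (simp add: norm_D algebra_simps)
  finally show ?thesis .
qed

end

text \<open>The larger of the bound \<open>(n + 1) \<gamma>\<^sup>n\<close> at the root and the bound at the other vertices,
  for \<open>\<gamma>, n \<ge> 1\<close>.\<close>

definition shift_norm :: "nat \<Rightarrow> nat \<Rightarrow> real" where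
  "shift_norm \<gamma> n = (if \<gamma> = 1 then real n + 1
     else (2 * real n + 1) * real \<gamma> ^ n - 2 * real n * real \<gamma> ^ (n - 1))"

lemma nonroot_bound_le_shift_norm:
  assumes "\<gamma> \<ge> 1"
  shows "real \<gamma> ^ Suc n + 2 * real (Suc n) * real (\<gamma> - 1) * real \<gamma> ^ n \<le> shift_norm \<gamma> (Suc n)"
  using assms by (auto simp: shift_norm_def of_nat_diff algebra_simps)

lemma root_bound_le_shift_norm:
  assumes "\<gamma> \<ge> 1"
  shows "(real (Suc n) + 1) * real \<gamma> ^ Suc n \<le> shift_norm \<gamma> (Suc n)"
proof (cases "\<gamma> = 1")
  case False
  \<comment> \<open>This product is the difference of the two sides.\<close>
  then have "0 \<le> (real n + 1) * real \<gamma> ^ n * (real \<gamma> - 2)"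
    using assms by simp
  then show ?thesis
    using False by (simp add: shift_norm_def algebra_simps)
qed (simp add: shift_norm_def)

lemma shift_norm_nonneg: "\<gamma> \<ge> 1 \<Longrightarrow> shift_norm \<gamma> (Suc n) \<ge> 0"
  by (rule order_trans[OF _ root_bound_le_shift_norm]) auto

lemma norm_tderiv_shift_le:
  assumes hom: "homogeneous \<gamma>" and f: "f \<in> L0" and v: "v \<in> pverts T"
  shows "cmod (tderiv ((backward_shift ^^ Suc n) f) v) \<le> shift_norm \<gamma> (Suc n) * L_norm f"
proof -
  have nonneg: "L_norm f \<ge> 0"
    using norm_tderiv_le_L_norm[OF f v] norm_ge_zero order_trans by blast
  show ?thesis
  proof (cases "v = root")
    case True
    let ?S = "(backward_shift ^^ Suc n) f root" and ?x = "of_nat \<gamma> ^ Suc n * f root"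
    have "cmod (?S - ?x) \<le> real (Suc n) * real \<gamma> ^ Suc n * L_norm f"
      using norm_tderiv_le_L_norm[OF f] root_in_verts
      by (intro norm_funpow_shift_minus[OF hom, of 0]) auto
    moreover have "cmod ?x \<le> real \<gamma> ^ Suc n * L_norm f"
      using norm_tderiv_le_L_norm[OF f root_in_verts]
      by (simp add: tderiv_def norm_mult norm_power mult_left_mono)
    ultimately have "cmod ?S \<le> (real (Suc n) + 1) * real \<gamma> ^ Suc n * L_norm f"
      using norm_triangle_ineq[of "?S - ?x" ?x] by (simp add: algebra_simps del: funpow.simps)
    also have "\<dots> \<le> shift_norm \<gamma> (Suc n) * L_norm f"
      using root_bound_le_shift_norm[OF order_ge_1[OF hom]] nonneg by (rule mult_right_mono)
    finally show ?thesis
      by (simp add: True tderiv_def)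
  next
    case False
    then have "0 < level v"
      using v level_eq_0_iff by blast
    then have "cmod (tderiv ((backward_shift ^^ Suc n) f) v)
        \<le> (real \<gamma> ^ Suc n + 2 * real (Suc n) * real (\<gamma> - 1) * real \<gamma> ^ n) * L_norm f"
      using norm_tderiv_le_L_norm[OF f] v False
      by (intro tderiv_shift_nonroot_le[OF hom, of 0]) auto
    also have "\<dots> \<le> shift_norm \<gamma> (Suc n) * L_norm f"
      using nonroot_bound_le_shift_norm[OF order_ge_1[OF hom]] nonneg by (rule mult_right_mono)
    finally show ?thesis .
  qed
qed

text \<open>The derivative of \<open>B\<^sup>n f\<close> at a vertex of level above \<open>m\<close> is controlled by the derivatives of
  \<open>f\<close> above level \<open>m\<close> alone, so decay at infinity is inherited.\<close>

lemma funpow_shift_in_L0: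
  assumes hom: "homogeneous \<gamma>" and f: "f \<in> L0"
  shows "(backward_shift ^^ Suc n) f \<in> L0"
  unfolding L0_iff
proof (intro conjI allI impI)
  fix v assume "v \<notin> pverts T"
  then show "(backward_shift ^^ Suc n) f v = 0"
    by (simp add: backward_shift_def Chi_eq_empty)
next
  fix e :: real assume "e > 0"
  define K where "K = real \<gamma> ^ Suc n + 2 * real (Suc n) * real (\<gamma> - 1) * real \<gamma> ^ n"
  have "K > 0"
    unfolding K_def using order_ge_1[OF hom] by (intro add_pos_nonneg) auto
  then have "e / (2 * K) > 0"
    using \<open>e > 0\<close> by simp
  then obtain m where m:
    "\<And>v. v \<in> pverts T \<Longrightarrow> m \<le> level v \<Longrightarrow> cmod (tderiv f v) < e / (2 * K)"
    using f unfolding L0_iff by meson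
  have "cmod (tderiv ((backward_shift ^^ Suc n) f) v) < e"
    if v: "v \<in> pverts T" "Suc m \<le> level v" for v
  proof -
    have "cmod (tderiv ((backward_shift ^^ Suc n) f) v) \<le> K * (e / (2 * K))"
    proof (rule tderiv_shift_nonroot_le[OF hom, of m f "e / (2 * K)" v n, folded K_def])
      show "cmod (tderiv f w) \<le> e / (2 * K)" if "w \<in> pverts T" "m < level w" for w
        using m[OF that(1)] that(2) by simp
    qed (use v level_root in auto)
    then show ?thesis
      using \<open>K > 0\<close> \<open>e > 0\<close> by simp
  qed
  then show "\<exists>m. \<forall>v\<in>pverts T. m \<le> level v \<longrightarrow> cmod (tderiv ((backward_shift ^^ Suc n) f) v) < e"
    by blast
qed

lemma L_norm_shift_le:
  assumes "homogeneous \<gamma>" "f \<in> L0"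
  shows "L_norm ((backward_shift ^^ Suc n) f) \<le> shift_norm \<gamma> (Suc n) * L_norm f"
  by (rule L_norm_leI) (rule norm_tderiv_shift_le[OF assms])

lemma funpow_shift_add:
  "(backward_shift ^^ n) (\<lambda>v. f v + g v) = (\<lambda>v. (backward_shift ^^ n) f v + (backward_shift ^^ n) g v)"
  by (induction n) (auto simp: backward_shift_def sum.distrib fun_eq_iff)

lemma funpow_shift_scale:
  "(backward_shift ^^ n) (\<lambda>v. c * f v) = (\<lambda>v. c * (backward_shift ^^ n) f v)"
  by (induction n) (auto simp: backward_shift_def sum_distrib_left fun_eq_iff)

lemma bounded_linear_funpow_shift:
  assumes "homogeneous \<gamma>"
  shows "bounded_linear_L0 (backward_shift ^^ Suc n)"
  unfolding bounded_linear_L0_def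
  using funpow_shift_in_L0[OF assms] L_norm_shift_le[OF assms] funpow_shift_add funpow_shift_scale
  by blast

section \<open>Extremal functions\<close>

text \<open>On a subtree where the sign is constant, the shift of a function of the level alone is again
  such a function. The lower end \<open>m\<close> of the levels is \<open>0\<close> if the whole tree has one sign and \<open>1\<close> if
  the children of the root have different signs.\<close>

lemma funpow_shift_radial:
  fixes s :: "'a \<Rightarrow> complex" and \<phi> :: "nat \<Rightarrow> complex"
  assumes hom: "homogeneous \<gamma>"
    and s: "\<And>v c. v \<in> pverts T \<Longrightarrow> m \<le> level v \<Longrightarrow> c \<in> Chi v \<Longrightarrow> s c = s v"
    and f: "\<And>v. v \<in> pverts T \<Longrightarrow> f v = s v * \<phi> (level v)"
    and v: "v \<in> pverts T" "m \<le> level v"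
  shows "(backward_shift ^^ n) f v = s v * of_nat \<gamma> ^ n * \<phi> (level v + n)"
  using v
proof (induction n arbitrary: v)
  case 0
  then show ?case by (simp add: f)
next
  case (Suc n)
  have "(backward_shift ^^ Suc n) f v = (\<Sum>c\<in>Chi v. s v * of_nat \<gamma> ^ n * \<phi> (level v + Suc n))"
    unfolding funpow_shift_Suc using Suc.prems
    by (intro sum.cong refl) (simp add: Suc.IH ChiD s)
  then show ?case
    using card_Chi[OF hom] Suc.prems by simp
qed

lemma in_L0_of_tderiv_eq_0:
  assumes "\<And>v. v \<notin> pverts T \<Longrightarrow> f v = 0"
    and "\<And>v. v \<in> pverts T \<Longrightarrow> m \<le> level v \<Longrightarrow> tderiv f v = 0"
  shows "f \<in> L0"
  unfolding L0_iff using assms by (metis norm_zero)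

lemma op_norm_shift_attained:
  assumes "homogeneous \<gamma>" "f \<in> L0" "L_norm f \<le> 1" "v \<in> pverts T"
    and "cmod (tderiv ((backward_shift ^^ Suc n) f) v) = shift_norm \<gamma> (Suc n)"
  shows "op_norm_L0 (backward_shift ^^ Suc n) = shift_norm \<gamma> (Suc n)"
  using L_norm_shift_le[OF assms(1)] shift_norm_nonneg[OF order_ge_1[OF assms(1)]] assms(2,3)
proof (rule op_norm_L0_eqI)
  show "shift_norm \<gamma> (Suc n) \<le> L_norm ((backward_shift ^^ Suc n) f)"
    using norm_tderiv_le_L_norm[OF funpow_shift_in_L0[OF assms(1,2)] assms(4), of n] assms(5) by simp
qed

lemma op_norm_shift_order_1:
  assumes hom: "homogeneous 1"
  shows "op_norm_L0 (backward_shift ^^ Suc n) = shift_norm 1 (Suc n)"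
proof -
  define \<phi> :: "nat \<Rightarrow> complex" where "\<phi> k = of_nat (min k (Suc n) + 1)" for k
  define f where "f v = (if v \<in> pverts T then \<phi> (level v) else 0)" for v
  have root: "tderiv f root = 1"
    using root_in_verts by (simp add: tderiv_def f_def \<phi>_def level_root)
  have nonroot: "tderiv f v = (if level v \<le> Suc n then 1 else 0)" if "v \<in> pverts T" "v \<noteq> root" for v
    using that level_eq_Suc[OF that] par_in_verts[OF that]
    by (auto simp: tderiv_def f_def \<phi>_def min_def le_Suc_eq)
  have "f \<in> L0"
    by (rule in_L0_of_tderiv_eq_0[of _ "n + 2"]) (use nonroot level_root in \<open>force simp: f_def\<close>)+
  moreover have "L_norm f \<le> 1"
  proof (rule L_norm_leI)
    show "cmod (tderiv f v) \<le> 1" if "v \<in> pverts T" for v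
      using root nonroot[OF that] by (cases "v = root") auto
  qed
  moreover have "(backward_shift ^^ Suc n) f root = 1 * of_nat 1 ^ Suc n * \<phi> (level root + Suc n)"
    by (rule funpow_shift_radial[OF hom, where m = 0 and s = "\<lambda>_. 1"])
      (simp_all add: f_def root_in_verts)
  then have "tderiv ((backward_shift ^^ Suc n) f) root = of_nat (n + 2)"
    by (simp add: tderiv_def level_root \<phi>_def del: funpow.simps)
  then have "cmod (tderiv ((backward_shift ^^ Suc n) f) root) = shift_norm 1 (Suc n)"
    by (simp only: norm_of_nat) (simp add: shift_norm_def)
  ultimately show ?thesis
    using op_norm_shift_attained[OF hom] root_in_verts by blast
qed

lemma op_norm_shift_order_ge_2:
  assumes hom: "homogeneous \<gamma>" and "\<gamma> \<ge> 2"
  shows "op_norm_L0 (backward_shift ^^ Suc n) = shift_norm \<gamma> (Suc n)"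
proof -
  have "card (Chi root) = \<gamma>"
    using card_Chi[OF hom root_in_verts] .
  then obtain v where v: "v \<in> Chi root"
    using \<open>\<gamma> \<ge> 2\<close> by fastforce
  \<comment> \<open>\<open>s\<close> is \<open>1\<close> in the subtree of \<open>v\<close> and \<open>-1\<close> below its siblings:
    going up \<open>level w - 1\<close> steps from \<open>w \<noteq> root\<close> leads to the child of the root above \<open>w\<close>.\<close>
  define s :: "'a \<Rightarrow> complex" where "s w = (if (par ^^ (level w - 1)) w = v then 1 else -1)" for w
  define \<phi> :: "nat \<Rightarrow> complex" where "\<phi> k = of_nat (min k (n + 2))" for k
  define f where "f w = (if w \<in> pverts T then s w * \<phi> (level w) else 0)" for w
  have s_child: "s c = s w" if "1 \<le> level w" "c \<in> Chi w" for w c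
  proof -
    obtain k where "level w = Suc k"
      using \<open>1 \<le> level w\<close> by (cases "level w") auto
    then show ?thesis
      using ChiD[OF that(2)] by (simp add: s_def funpow_swap1)
  qed
  have s_top: "s c = (if c = v then 1 else -1)" if "c \<in> Chi root" for c
    using ChiD[OF that] by (simp add: s_def level_root)
  have norm_s: "cmod (s w) = 1" for w
    by (simp add: s_def)
  have \<phi>_increment: "\<phi> (Suc k) - \<phi> k = (if Suc k \<le> n + 2 then 1 else 0)" for k
    by (cases "Suc k \<le> n + 2") (simp_all add: \<phi>_def min.absorb1 min.absorb2)
  have root: "tderiv f root = 0"
    by (simp add: tderiv_def f_def \<phi>_def level_root)
  have nonroot: "tderiv f w = s w * (if level w \<le> n + 2 then 1 else 0)"
    if w: "w \<in> pverts T" "w \<noteq> root" for w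
  proof -
    have "tderiv f w = s w * \<phi> (level w) - s (par w) * \<phi> (level (par w))"
      using w par_in_verts by (simp add: tderiv_def f_def)
    also have "s (par w) * \<phi> (level (par w)) = s w * \<phi> (level (par w))"
      using s_child[of "par w" w] in_Chi_par[OF w] by (cases "level (par w)") (auto simp: \<phi>_def)
    finally show ?thesis
      using \<phi>_increment[of "level (par w)"] by (simp add: level_eq_Suc[OF w] flip: right_diff_distrib)
  qed
  have radial: "(backward_shift ^^ k) f c = s c * of_nat \<gamma> ^ k * \<phi> (Suc k)"
    if "c \<in> Chi root" for c k
    using funpow_shift_radial[OF hom, of 1 s f \<phi> c k] s_child ChiD[OF that]
    by (simp add: f_def level_root)
  have "f \<in> L0"
    by (rule in_L0_of_tderiv_eq_0[of _ "n + 3"]) (use nonroot level_root in \<open>force simp: f_def\<close>)+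
  moreover have "L_norm f \<le> 1"
  proof (rule L_norm_leI)
    show "cmod (tderiv f w) \<le> 1" if "w \<in> pverts T" for w
      using root nonroot[OF that] by (cases "w = root") (auto simp: norm_s norm_mult)
  qed
  moreover have "cmod (tderiv ((backward_shift ^^ Suc n) f) v) = shift_norm \<gamma> (Suc n)"
  proof -
    have "(\<Sum>c\<in>Chi root. s c) = s v + (\<Sum>c\<in>Chi root - {v}. s c)"
      using v finite_Chi by (simp add: sum.remove)
    also have "\<dots> = 1 + (\<Sum>c\<in>Chi root - {v}. -1)"
      using v s_top by (intro arg_cong2[where f = "(+)"] sum.cong) auto
    also have "\<dots> = 2 - of_nat \<gamma>"
      using v finite_Chi \<open>card (Chi root) = \<gamma>\<close> \<open>\<gamma> \<ge> 2\<close> by (simp add: of_nat_diff)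
    finally have sum_s: "(\<Sum>c\<in>Chi root. s c) = 2 - of_nat \<gamma>" .
    have "(backward_shift ^^ Suc n) f root = (\<Sum>c\<in>Chi root. s c) * (of_nat \<gamma> ^ n * \<phi> (Suc n))"
      unfolding funpow_shift_Suc sum_distrib_right
      by (intro sum.cong refl) (simp add: radial mult.assoc)
    also have "\<dots> = (2 - of_nat \<gamma>) * of_nat \<gamma> ^ n * of_nat (n + 1)"
      by (simp add: sum_s \<phi>_def)
    finally have "tderiv ((backward_shift ^^ Suc n) f) v
        = of_nat \<gamma> ^ Suc n * of_nat (n + 2) - (2 - of_nat \<gamma>) * of_nat \<gamma> ^ n * of_nat (n + 1)"
      using radial[OF v, of "Suc n"] s_top[OF v]
      by (simp only: tderiv_child[OF v]) (simp add: \<phi>_def)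
    also have "\<dots> = of_real (shift_norm \<gamma> (Suc n))"
      using \<open>\<gamma> \<ge> 2\<close> by (simp add: shift_norm_def algebra_simps)
    finally show ?thesis
      using shift_norm_nonneg[of \<gamma> n] \<open>\<gamma> \<ge> 2\<close> by simp
  qed
  ultimately show ?thesis
    using op_norm_shift_attained[OF hom] ChiD(1)[OF v] by blast
qed

end

section \<open>The norm of the iterated backward shift\<close>

theorem theorem5p5:
  fixes T :: "'a pair_pre_digraph" and root :: 'a and \<gamma> :: nat
  assumes "rooted_tree T root"
    and "rooted_tree.homogeneous T root \<gamma>"
  shows "\<forall>n\<ge>1.
    rooted_tree.bounded_linear_L0 T root (rooted_tree.backward_shift T root ^^ n) \<and>
    (\<gamma> = 1 \<longrightarrow>
       rooted_tree.op_norm_L0 T root (rooted_tree.backward_shift T root ^^ n) = real n + 1) \<and>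
    (\<gamma> \<ge> 2 \<longrightarrow>
       rooted_tree.op_norm_L0 T root (rooted_tree.backward_shift T root ^^ n)
         = (2 * real n + 1) * real \<gamma> ^ n - 2 * real n * real \<gamma> ^ (n - 1))"
proof (intro allI impI)
  interpret rooted_tree T root by (fact assms(1))
  fix n :: nat assume "n \<ge> 1"
  then obtain k where n: "n = Suc k"
    using Suc_le_D by auto
  have "op_norm_L0 (backward_shift ^^ n) = shift_norm \<gamma> n"
    using op_norm_shift_order_1[of k] op_norm_shift_order_ge_2[of \<gamma> k] order_ge_1[of \<gamma>] assms(2)
    unfolding n by (cases "\<gamma> = 1") auto
  moreover have "bounded_linear_L0 (backward_shift ^^ n)"
    unfolding n by (rule bounded_linear_funpow_shift[OF assms(2)])
  ultimately show "bounded_linear_L0 (backward_shift ^^ n) \<and>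
    (\<gamma> = 1 \<longrightarrow> op_norm_L0 (backward_shift ^^ n) = real n + 1) \<and>
    (\<gamma> \<ge> 2 \<longrightarrow> op_norm_L0 (backward_shift ^^ n)
       = (2 * real n + 1) * real \<gamma> ^ n - 2 * real n * real \<gamma> ^ (n - 1))"
    by (simp add: shift_norm_def)
qed

end
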